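(* Let the ILRFPP model on $\mathbb{Z}^d$ satisfy the standing assumptions, and suppose $\alpha<d/\theta$. Then $T(0,x)=0$ almost surely for every $x\in\mathbb{Z}^d$.
   Context: Model (inhomogeneous long-range first-passage percolation, ILRFPP). Fix an integer $d\ge1$ and $\alpha>0$; $\|\cdot\|$ is the $\ell_1$ norm on $\mathbb{Z}^d$. The vertex weights $(V_x)_{x\in\mathbb{Z}^d}$ are i.i.d. with the law of a random variable $V$; the edge noises $\omega_{xy}=\omega_{yx}\ge0$, one for every unordered pair $\{x,y\}$ of distinct vertices of $\mathbb{Z}^d$ (all pairs are edges), are i.i.d. with the law of $\omega$, and independent of the vertex weights. The passage time of an edge is $W_{xy}:=\|x-y\|^{\alpha}\,\omega_{xy}/(V_xV_y)$. A path is a finite sequence of distinct vertices; its passage time is the sum of $W$ over its consecutive edges. $T(x,y)$ is the infimum of the passage times over all finite self-avoiding paths from $x$ to $y$ (so $T(x,x)=0$). Standing assumptions: for fixed $\gamma,\theta,\zeta>0$, $\mathbb{P}(0<V<\infty)=1$ and $\lim_{x\to\infty}\log\mathbb{P}(V\ge x)/\log x=-\gamma$; $\lim_{x\downarrow0}\log\mathbb{P}(\omega\le x)/\log x=\theta$ and $\mathbb{E}\,\omega^{\zeta}<\infty$. *)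

theory Defs
  imports "HOL-Probability.Probability"
begin

definition l1norm :: "int ^ 'd \<Rightarrow> real" where
  "l1norm x = (\<Sum>i\<in>UNIV. \<bar>real_of_int (x $ i)\<bar>)"

text \<open>Edges are two-element sets of vertices, so that the noise on \<open>{x, y}\<close> is symmetric in
  \<open>x\<close> and \<open>y\<close>.\<close>

definition all_edges :: "'v set set" where
  "all_edges = {{x, y} | x y. x \<noteq> y}"

definition edge_time ::
  "real \<Rightarrow> (int ^ 'd \<Rightarrow> 'w \<Rightarrow> real) \<Rightarrow> ((int ^ 'd) set \<Rightarrow> 'w \<Rightarrow> real) \<Rightarrow>
   int ^ 'd \<Rightarrow> int ^ 'd \<Rightarrow> 'w \<Rightarrow> real" where
  "edge_time \<alpha> V \<omega> x y w = l1norm (x - y) powr \<alpha> * \<omega> {x, y} w / (V x w * V y w)"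

definition paths :: "'v \<Rightarrow> 'v \<Rightarrow> 'v list set" where
  "paths x y = {p. p \<noteq> [] \<and> distinct p \<and> hd p = x \<and> last p = y}"

definition path_time ::
  "real \<Rightarrow> (int ^ 'd \<Rightarrow> 'w \<Rightarrow> real) \<Rightarrow> ((int ^ 'd) set \<Rightarrow> 'w \<Rightarrow> real) \<Rightarrow>
   (int ^ 'd) list \<Rightarrow> 'w \<Rightarrow> real" where
  "path_time \<alpha> V \<omega> p w = (\<Sum>i<length p - 1. edge_time \<alpha> V \<omega> (p ! i) (p ! Suc i) w)"

text \<open>The set of paths is never empty, and under the assumptions below all edge times are almost
  surely nonnegative, so the real infimum is almost surely the true one.\<close>

definition passage_time ::
  "real \<Rightarrow> (int ^ 'd \<Rightarrow> 'w \<Rightarrow> real) \<Rightarrow> ((int ^ 'd) set \<Rightarrow> 'w \<Rightarrow> real) \<Rightarrow>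
   int ^ 'd \<Rightarrow> int ^ 'd \<Rightarrow> 'w \<Rightarrow> real" where
  "passage_time \<alpha> V \<omega> x y w = (INF p\<in>paths x y. path_time \<alpha> V \<omega> p w)"

text \<open>\<open>\<mu>\<close> and \<open>\<nu>\<close> are the laws of the generic vertex weight and edge noise.  Joint independence of
  the combined family, indexed by the disjoint union of vertices and edges, says that each of the
  two families is independent and that they are independent of each other.\<close>

locale ilrfpp = prob_space M
  for M :: "'w measure"
    and \<alpha> :: real
    and V :: "int ^ 'd \<Rightarrow> 'w \<Rightarrow> real"
    and \<omega> :: "(int ^ 'd) set \<Rightarrow> 'w \<Rightarrow> real"
    and \<mu> \<nu> :: "real measure" +
  assumes alpha_pos: "\<alpha> > 0"
    and indep: "indep_vars (\<lambda>_. borel) (case_sum V \<omega>) (UNIV <+> all_edges)"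
    and weight_law: "\<And>x. distr M borel (V x) = \<mu>"
    and noise_law: "\<And>e. e \<in> all_edges \<Longrightarrow> distr M borel (\<omega> e) = \<nu>"
    and noise_nonneg: "AE t in \<nu>. t \<ge> 0"

text \<open>Since \<open>ln 0 = 0\<close> here and \<open>\<gamma>, \<theta> > 0\<close>, the two limits fail, as they should, for a bounded weight
  or for a noise bounded away from \<open>0\<close>.  Finiteness of the weight is built into its type.\<close>

locale ilrfpp_standing = ilrfpp M \<alpha> V \<omega> \<mu> \<nu>
  for M :: "'w measure"
    and \<alpha> :: real
    and V :: "int ^ 'd \<Rightarrow> 'w \<Rightarrow> real"
    and \<omega> :: "(int ^ 'd) set \<Rightarrow> 'w \<Rightarrow> real"
    and \<mu> \<nu> :: "real measure" +
  fixes \<gamma> \<theta> \<zeta> :: real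
  assumes exponents_pos: "\<gamma> > 0" "\<theta> > 0" "\<zeta> > 0"
    and weight_pos: "AE t in \<mu>. t > 0"
    and weight_tail: "((\<lambda>x. ln (measure \<mu> {x..}) / ln x) \<longlongrightarrow> - \<gamma>) at_top"
    and noise_tail: "((\<lambda>x. ln (measure \<nu> {..x}) / ln x) \<longlongrightarrow> \<theta>) (at_right 0)"
    and noise_moment: "integrable \<nu> (\<lambda>t. t powr \<zeta>)"

end

theory Submission
  imports Defs "HOL-Real_Asymp.Real_Asymp"
begin

text \<open>
  The hypothesis \<open>\<alpha> \<theta> < d\<close> makes even the longest edges of a large box useful.  Fix \<open>\<beta>\<close> with
  \<open>\<alpha> < \<beta> < d / \<theta>\<close>, let \<open>A\<close> be the box of radius \<open>N\<close>, with \<open>n\<close> of order \<open>N ^ d\<close> vertices, and call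
  an edge inside \<open>A\<close> cheap if its noise is at most \<open>N powr (- \<beta>)\<close>.  If both ends have weight at
  least a constant \<open>c\<close>, a cheap edge costs at most a constant times \<open>N powr (\<alpha> - \<beta>)\<close>, whatever its
  length.  On the other hand an edge is cheap with a probability \<open>p\<close> of about \<open>N powr (- \<beta> \<theta>)\<close>, so
  \<open>n * p\<close> exceeds some \<open>N powr \<delta>\<close> with \<open>\<delta> > 0\<close>: the cheap edges form an Erdos--Renyi
  graph whose mean degree is a positive power of its number of vertices.

  Such a graph is an expander with high probability, and this is proved by a single union bound over
  pairs \<open>(S, Z)\<close>, where \<open>Z\<close> plays the role of the closed neighbourhood of \<open>S\<close>.  If \<open>Z\<close> is small, no
  cheap edge joins \<open>S\<close> to the order of \<open>n\<close> vertices outside \<open>Z\<close>, which has probability at most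
  \<open>exp (- p n / 8) ^ card S\<close>; the number of pairs is only \<open>n ^ (3 * card S)\<close>
  (\<open>sum_cut_candidates_le\<close>, \<open>prob_good_not_expanding\<close>).  In an expander, balls grow by the factor
  \<open>3 / 2\<close> until they contain more than half of the vertices, so two balls of logarithmic radius
  meet, and any two vertices are joined by a path of logarithmic length
  (\<open>expanding_short_path\<close>).  Hence \<open>0\<close> and \<open>x\<close> are joined at a cost of order
  \<open>ln N * N powr (\<alpha> - \<beta>)\<close>, which tends to \<open>0\<close>.

  The random weights enter through the set of good sites, those of weight at least \<open>c\<close>.  Weights can
  be arbitrarily close to \<open>0\<close>, so \<open>c\<close> is kept fixed while \<open>N\<close> grows; for small \<open>c\<close> both endpoints are
  good and, by Markov's inequality, at least half of the box is good with probability close to \<open>1\<close>.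
  The graph estimate is applied on each possible set of good sites separately, which is legitimate
  since weights and noises are independent (\<open>prob_pattern_no_cheap\<close>).  Letting first \<open>N\<close> tend to
  infinity and then \<open>c\<close> to \<open>0\<close> yields paths of arbitrarily small cost with probability arbitrarily
  close to \<open>1\<close> (\<open>cheap_path_likely\<close>), hence almost surely.
\<close>

section \<open>Expanding graphs have logarithmic diameter\<close>

definition closed_nbhd :: "('a \<Rightarrow> 'a \<Rightarrow> bool) \<Rightarrow> 'a set \<Rightarrow> 'a set \<Rightarrow> 'a set" where
  "closed_nbhd E A S = {y \<in> A. \<exists>s\<in>S. y = s \<or> E s y}"

text \<open>The factor \<open>3 / 2\<close> is compatible with the bound \<open>2 * card S \<le> card A\<close>: a set that violates the
  inequality has a closed neighbourhood of less than three quarters of \<open>A\<close>.\<close>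

definition expanding :: "('a \<Rightarrow> 'a \<Rightarrow> bool) \<Rightarrow> 'a set \<Rightarrow> bool" where
  "expanding E A \<longleftrightarrow> (\<forall>S\<subseteq>A. S \<noteq> {} \<longrightarrow> 2 * card S \<le> card A \<longrightarrow>
     3 * card S \<le> 2 * card (closed_nbhd E A S))"

lemma closed_nbhd_subset: "closed_nbhd E A S \<subseteq> A"
  by (auto simp: closed_nbhd_def)

lemma closed_nbhd_increasing: "S \<subseteq> A \<Longrightarrow> S \<subseteq> closed_nbhd E A S"
  by (auto simp: closed_nbhd_def)

text \<open>Cutting out the loop between two visits of a vertex shortens the walk, so induction on the length
  ends at a walk without repetition.\<close>

lemma walk_shortens_to_path:
  assumes "successively E p" "p \<noteq> []"
  shows "\<exists>q. q \<noteq> [] \<and> distinct q \<and> successively E q \<and> hd q = hd p \<and> last q = last p \<and>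
           length q \<le> length p \<and> set q \<subseteq> set p"
  using assms
proof (induction "length p" arbitrary: p rule: less_induct)
  case less
  show ?case
  proof (cases "distinct p")
    case True
    then show ?thesis using less.prems by blast
  next
    case False
    then obtain xs ys zs y where p: "p = xs @ [y] @ ys @ [y] @ zs"
      using not_distinct_decomp by blast
    let ?r = "xs @ [y] @ zs"
    have "successively E ?r" using less.prems(1)
      by (auto simp: p successively_append_iff successively_Cons)
    moreover have "length ?r < length p" "?r \<noteq> []" by (auto simp: p)
    moreover have "hd ?r = hd p" "last ?r = last p" "set ?r \<subseteq> set p"
      by (auto simp: p hd_append)
    ultimately show ?thesis using less.hyps[of ?r] by fastforce
  qed
qed

lemma ball_walk:
  assumes "u \<in> A" "y \<in> (closed_nbhd E A ^^ j) {u}"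
  shows "\<exists>p. p \<noteq> [] \<and> hd p = u \<and> last p = y \<and> set p \<subseteq> A \<and> successively E p \<and> length p \<le> Suc j"
  using assms(2)
proof (induction j arbitrary: y)
  case 0
  then show ?case using assms(1) by (intro exI[of _ "[u]"]) auto
next
  case (Suc j)
  let ?B = "(closed_nbhd E A ^^ j) {u}"
  have "y \<in> closed_nbhd E A ?B" using Suc.prems by simp
  then obtain s where s: "s \<in> ?B" "y = s \<or> E s y" and y: "y \<in> A"
    unfolding closed_nbhd_def by blast
  from Suc.IH[OF s(1)] obtain p where
    p: "p \<noteq> []" "hd p = u" "last p = s" "set p \<subseteq> A" "successively E p" "length p \<le> Suc j"
    by blast
  show ?case
  proof (cases "y = s")
    case True
    then show ?thesis using p by (intro exI[of _ p]) auto
  next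
    case False
    then show ?thesis using p s y
      by (intro exI[of _ "p @ [y]"]) (auto simp: successively_append_iff)
  qed
qed

lemma ball_grows:
  assumes "expanding E A" "finite A" "u \<in> A"
  shows "(closed_nbhd E A ^^ j) {u} \<subseteq> A \<and>
    (card A < 2 * card ((closed_nbhd E A ^^ j) {u}) \<or>
     (3 / 2) ^ j \<le> real (card ((closed_nbhd E A ^^ j) {u})))"
proof (induction j)
  case 0
  then show ?case using assms(3) by auto
next
  case (Suc j)
  let ?B = "(closed_nbhd E A ^^ j) {u}"
  have sub: "?B \<subseteq> A" using Suc by blast
  have le: "card ?B \<le> card (closed_nbhd E A ?B)"
    by (intro card_mono closed_nbhd_increasing sub finite_subset[OF closed_nbhd_subset assms(2)])
  show ?case
  proof (cases "card A < 2 * card ?B")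
    case True
    then show ?thesis using le closed_nbhd_subset[of E A ?B] by simp
  next
    case False
    then have pw: "(3 / 2) ^ j \<le> real (card ?B)" using Suc by blast
    then have "?B \<noteq> {}"
      by (metis card.empty of_nat_0 not_le zero_less_power zero_less_divide_iff zero_less_numeral)
    then have "3 * card ?B \<le> 2 * card (closed_nbhd E A ?B)"
      using assms(1) sub False unfolding expanding_def by simp
    then have "3 * real (card ?B) \<le> 2 * real (card (closed_nbhd E A ?B))" by linarith
    then show ?thesis using pw closed_nbhd_subset[of E A ?B] by simp
  qed
qed

text \<open>After \<open>J\<close> steps the second alternative of \<open>ball_grows\<close> is impossible, so the balls around \<open>u\<close> and
  \<open>v\<close> both contain more than half of \<open>A\<close> and share a vertex; the walk from \<open>u\<close> to it is continued by
  the reversed walk from \<open>v\<close>.\<close>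

lemma expanding_short_path:
  assumes exp: "expanding E A" and fin: "finite A" and sym: "symp E" and uv: "u \<in> A" "v \<in> A"
    and J: "real (card A) < (3 / 2) ^ J"
  shows "\<exists>p\<in>paths u v. successively E p \<and> set p \<subseteq> A \<and> length p \<le> 2 * J + 1"
proof -
  let ?B = "\<lambda>u. (closed_nbhd E A ^^ J) {u}"
  have big: "?B z \<subseteq> A \<and> card A < 2 * card (?B z)" if "z \<in> A" for z
  proof -
    have *: "?B z \<subseteq> A" and d: "card A < 2 * card (?B z) \<or> (3 / 2) ^ J \<le> real (card (?B z))"
      using ball_grows[OF exp fin that, of J] by auto
    have "real (card (?B z)) \<le> real (card A)" using card_mono[OF fin *] by simp
    then show ?thesis using * d J by auto
  qed
  have "?B u \<inter> ?B v \<noteq> {}"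
  proof
    assume dis: "?B u \<inter> ?B v = {}"
    have "finite (?B u)" "finite (?B v)" using big uv fin by (meson finite_subset)+
    then have "card (?B u) + card (?B v) = card (?B u \<union> ?B v)"
      using dis by (simp add: card_Un_disjoint)
    also have "\<dots> \<le> card A" using big uv by (intro card_mono fin) blast
    finally show False using big[OF uv(1)] big[OF uv(2)] by linarith
  qed
  then obtain y where y: "y \<in> ?B u" "y \<in> ?B v" by blast
  obtain p where p: "p \<noteq> []" "hd p = u" "last p = y" "set p \<subseteq> A" "successively E p" "length p \<le> Suc J"
    using ball_walk[OF uv(1) y(1)] by blast
  obtain q where q: "q \<noteq> []" "hd q = v" "last q = y" "set q \<subseteq> A" "successively E q" "length q \<le> Suc J"
    using ball_walk[OF uv(2) y(2)] by blast
  have sr: "successively E (rev q)"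
    using q(5) sym by (simp add: successively_rev) (metis (mono_tags, lifting) successively_mono sympD)
  obtain rs where rs: "rev q = y # rs" using q(1,3) by (cases "rev q") (auto simp: hd_rev[symmetric])
  have rq: "q = rev rs @ [y]" using rs by (metis rev_rev_ident rev.simps(2))
  let ?w = "p @ rs"
  have "successively E ?w" using p sr rs
    by (auto simp: successively_append_iff successively_Cons)
  moreover have "?w \<noteq> []" "hd ?w = u" using p by auto
  moreover have "last ?w = v" using p(1,3) q(2) rq by (cases rs) (auto simp: hd_append last_rev[symmetric] hd_rev)
  moreover have "length ?w \<le> 2 * J + 1" "set ?w \<subseteq> A" using p(4,6) q(4,6) rq by auto
  ultimately show ?thesis using walk_shortens_to_path[of E ?w]
    unfolding paths_def by fastforce
qed

text \<open>Every such set is the range of a list of length \<open>k\<close>, obtained from an enumeration by repeating an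
  entry.\<close>

lemma card_small_subsets:
  assumes "finite A"
  shows "card {S. S \<subseteq> A \<and> S \<noteq> {} \<and> card S \<le> k} \<le> card A ^ k"
proof -
  have fin: "finite {xs. set xs \<subseteq> A \<and> length xs = k}" by (rule finite_lists_length_eq[OF assms])
  have "{S. S \<subseteq> A \<and> S \<noteq> {} \<and> card S \<le> k} \<subseteq> set ` {xs. set xs \<subseteq> A \<and> length xs = k}"
  proof
    fix S assume "S \<in> {S. S \<subseteq> A \<and> S \<noteq> {} \<and> card S \<le> k}"
    then have S: "S \<subseteq> A" "S \<noteq> {}" "card S \<le> k" by auto
    obtain xs where xs: "set xs = S" "distinct xs"
      using finite_distinct_list finite_subset[OF S(1) assms] by blast
    let ?ys = "xs @ replicate (k - card S) (hd xs)"
    have "xs \<noteq> []" using xs(1) S(2) by auto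
    then have "hd xs \<in> S" using xs(1) hd_in_set by blast
    then have "set ?ys = S" using xs(1) by (auto simp: set_replicate_conv_if)
    moreover have "length ?ys = k" using S(3) xs distinct_card by fastforce
    ultimately show "S \<in> set ` {xs. set xs \<subseteq> A \<and> length xs = k}" using S(1) by blast
  qed
  then have "card {S. S \<subseteq> A \<and> S \<noteq> {} \<and> card S \<le> k} \<le> card {xs. set xs \<subseteq> A \<and> length xs = k}"
    by (rule surj_card_le[OF fin])
  then show ?thesis using card_lists_length_eq[OF assms] by simp
qed

text \<open>The pairs \<open>(S, Z)\<close> in which \<open>Z\<close> can be the closed neighbourhood of a set \<open>S\<close> that fails to expand.
  Only inclusions and sizes are recorded, so that the pairs do not depend on the edges and a union bound over
  them is possible.\<close>

definition cut_candidates :: "'a set \<Rightarrow> ('a set \<times> 'a set) set" where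
  "cut_candidates A = {(S, Z). S \<subseteq> Z \<and> Z \<subseteq> A \<and> S \<noteq> {} \<and> card Z \<le> 2 * card S \<and>
     4 * card Z \<le> 3 * card A}"

lemma finite_cut_candidates: "finite A \<Longrightarrow> finite (cut_candidates A)"
  by (rule finite_subset[of _ "Pow A \<times> Pow A"]) (auto simp: cut_candidates_def)

lemma not_expanding_cut:
  assumes "finite A" "\<not> expanding E A"
  shows "\<exists>(S, Z)\<in>cut_candidates A. \<forall>s\<in>S. \<forall>y\<in>A - Z. \<not> E s y"
proof -
  obtain S where S: "S \<subseteq> A" "S \<noteq> {}" "2 * card S \<le> card A"
    "\<not> 3 * card S \<le> 2 * card (closed_nbhd E A S)"
    using assms(2) unfolding expanding_def by blast
  let ?Z = "closed_nbhd E A S"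
  have "(S, ?Z) \<in> cut_candidates A"
    using S closed_nbhd_subset[of E A S] closed_nbhd_increasing[OF S(1), of E]
    by (auto simp: cut_candidates_def)
  moreover have "\<forall>s\<in>S. \<forall>y\<in>A - ?Z. \<not> E s y" by (auto simp: closed_nbhd_def)
  ultimately show ?thesis by blast
qed

text \<open>There are at most \<open>n ^ s * n ^ (2 * s)\<close> pairs with \<open>card S = s\<close>, so the sum is dominated by
  \<open>\<Sum>s\<in>{1..n}. (n ^ 3 * b) ^ s\<close>, whose terms are at most the first one because its
  base is at most \<open>1\<close>.\<close>

lemma sum_cut_candidates_le:
  assumes fin: "finite A" and n: "card A \<le> n" and b: "b \<ge> 0" and q: "real n ^ 3 * b \<le> 1"
  shows "(\<Sum>(S, Z)\<in>cut_candidates A. b ^ card S) \<le> real n ^ 4 * b"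
proof -
  let ?I = "cut_candidates A"
  let ?q = "real n ^ 3 * b"
  have q0: "?q \<ge> 0" using b by simp
  have rng: "(\<lambda>(S, Z). card S) ` ?I \<subseteq> {1..n}"
  proof safe
    fix S Z assume "(S, Z) \<in> ?I"
    then have "S \<subseteq> A" "S \<noteq> {}" unfolding cut_candidates_def by blast+
    then have "card S \<le> card A" "card S > 0"
      using card_mono[OF fin] finite_subset[OF _ fin] by (auto simp: card_gt_0_iff)
    then show "card S \<in> {1..n}" using n by simp
  qed
  have each: "(\<Sum>(S, Z)\<in>{x \<in> ?I. (case x of (S, Z) \<Rightarrow> card S) = s}. b ^ card S) \<le> ?q"
    if s: "s \<in> {1..n}" for s
  proof -
    let ?Is = "{x \<in> ?I. (case x of (S, Z) \<Rightarrow> card S) = s}"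
    let ?P = "\<lambda>k. {S. S \<subseteq> A \<and> S \<noteq> {} \<and> card S \<le> k}"
    have finP: "finite (?P k)" for k by (rule finite_subset[of _ "Pow A"]) (auto simp: fin)
    have "?Is \<subseteq> ?P s \<times> ?P (2 * s)" by (auto simp: cut_candidates_def)
    then have "card ?Is \<le> card (?P s \<times> ?P (2 * s))" by (intro card_mono finite_cartesian_product finP)
    also have "\<dots> \<le> card A ^ s * card A ^ (2 * s)"
      unfolding card_cartesian_product by (intro mult_mono card_small_subsets fin) auto
    also have "\<dots> = (card A ^ 3) ^ s" by (simp add: power_add[symmetric] power_mult[symmetric])
    also have "\<dots> \<le> (n ^ 3) ^ s" using n by (intro power_mono) auto
    finally have "real (card ?Is) \<le> real ((n ^ 3) ^ s)" by (rule of_nat_mono)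
    then have c: "real (card ?Is) \<le> (real n ^ 3) ^ s" by simp
    have "(\<Sum>(S, Z)\<in>?Is. b ^ card S) = (\<Sum>_\<in>?Is. b ^ s)" by (rule sum.cong) auto
    also have "\<dots> = real (card ?Is) * b ^ s" by simp
    also have "\<dots> \<le> (real n ^ 3) ^ s * b ^ s" using c b by (intro mult_right_mono) auto
    also have "\<dots> = ?q ^ s" by (simp add: power_mult_distrib)
    also have "\<dots> \<le> ?q ^ 1" using s q q0 by (intro power_decreasing) auto
    finally show ?thesis by simp
  qed
  have "(\<Sum>(S, Z)\<in>?I. b ^ card S) =
      (\<Sum>s\<in>{1..n}. \<Sum>(S, Z)\<in>{x \<in> ?I. (case x of (S, Z) \<Rightarrow> card S) = s}. b ^ card S)"
    by (rule sum.group[symmetric]) (use rng fin finite_cut_candidates in auto)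
  also have "\<dots> \<le> (\<Sum>s\<in>{1..n}. ?q)" by (rule sum_mono[OF each])
  also have "\<dots> = real n ^ 4 * b" by (simp add: power_numeral_reduce)
  finally show ?thesis .
qed

section \<open>Cheap edges between good sites\<close>

lemma doubleton_in_all_edges: "s \<noteq> y \<Longrightarrow> {s, y} \<in> all_edges"
  by (auto simp: all_edges_def)

context ilrfpp
begin

lemma weight_measurable [measurable]: "V x \<in> borel_measurable M"
  using indep unfolding indep_vars_def by (metis (no_types, lifting) InlI UNIV_I old.sum.simps(5))

lemma noise_measurable [measurable]: "e \<in> all_edges \<Longrightarrow> \<omega> e \<in> borel_measurable M"
  using indep unfolding indep_vars_def by (metis (no_types, lifting) InrI old.sum.simps(6))

lemma prob_weight: "B \<in> sets borel \<Longrightarrow> prob (V x -` B \<inter> space M) = measure \<mu> B"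
  using weight_law[of x] by (auto simp: measure_distr)

lemma prob_noise: "e \<in> all_edges \<Longrightarrow> B \<in> sets borel \<Longrightarrow> prob (\<omega> e -` B \<inter> space M) = measure \<nu> B"
  using measure_distr[OF noise_measurable, of e B] noise_law[of e] by simp

lemma prob_space_weight: "prob_space \<mu>"
  using weight_law[of undefined] prob_space_distr[OF weight_measurable] by metis

lemma sets_weight: "sets \<mu> = sets borel"
  using weight_law[of undefined] by (metis sets_distr)

definition good_sites :: "(int ^ 'd) set \<Rightarrow> real \<Rightarrow> 'w \<Rightarrow> (int ^ 'd) set" where
  "good_sites A c w = {y \<in> A. c \<le> V y w}"

definition cheap :: "real \<Rightarrow> 'w \<Rightarrow> int ^ 'd \<Rightarrow> int ^ 'd \<Rightarrow> bool" where
  "cheap t w s y \<longleftrightarrow> s \<noteq> y \<and> \<omega> {s, y} w \<le> t"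

lemma good_sites_event [measurable]:
  assumes "finite A"
  shows "{w \<in> space M. good_sites A c w = G} \<in> events"
proof (cases "G \<subseteq> A")
  case True
  have "{w \<in> space M. good_sites A c w = G} = {w \<in> space M. \<forall>y\<in>A. y \<in> G \<longleftrightarrow> c \<le> V y w}"
    using True by (auto simp: good_sites_def)
  also have "\<dots> \<in> events" using assms by measurable
  finally show ?thesis .
next
  case False
  then have "{w \<in> space M. good_sites A c w = G} = {}" by (auto simp: good_sites_def)
  then show ?thesis by (metis sets.empty_sets)
qed

lemma no_cheap_event [measurable]:
  assumes "finite S" "finite T" "S \<inter> T = {}"
  shows "{w \<in> space M. \<forall>s\<in>S. \<forall>y\<in>T. \<not> cheap t w s y} \<in> events"
proof -
  have "{w \<in> space M. \<forall>s\<in>S. \<forall>y\<in>T. \<not> cheap t w s y} =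
      {w \<in> space M. \<forall>(s, y)\<in>S \<times> T. \<not> \<omega> {s, y} w \<le> t}"
    using assms(3) unfolding cheap_def by fast
  also have "\<dots> = {w \<in> space M. \<forall>p\<in>S \<times> T. \<not> \<omega> {fst p, snd p} w \<le> t}" by auto
  also have "\<dots> \<in> events"
  proof (rule sets.sets_Collect_finite_All)
    fix p assume p: "p \<in> S \<times> T"
    then have "fst p \<noteq> snd p" using assms(3) by auto
    note [measurable] = noise_measurable[OF doubleton_in_all_edges[OF this]]
    show "{w \<in> space M. \<not> \<omega> {fst p, snd p} w \<le> t} \<in> events" by measurable
  next
    show "finite (S \<times> T)" using assms by simp
  qed
  finally show ?thesis .
qed

text \<open>The event prescribes, for finitely many weights and noises, on which side of a threshold each of
  them lies.  Since \<open>S\<close> and \<open>T\<close> are disjoint, the pairs in \<open>S \<times> T\<close> are distinct edges, so that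
  independence gives the exponent \<open>card S * card T\<close>.\<close>

lemma prob_pattern_no_cheap:
  assumes "finite A" "A \<noteq> {}" "G \<subseteq> A" "finite S" "finite T" "S \<inter> T = {}"
  shows "prob {w \<in> space M. good_sites A c w = G \<and> (\<forall>s\<in>S. \<forall>y\<in>T. \<not> cheap t w s y)} =
    prob {w \<in> space M. good_sites A c w = G} * (measure \<nu> {t<..}) ^ (card S * card T)"
proof -
  define ed :: "(int ^ 'd) \<times> (int ^ 'd) \<Rightarrow> (int ^ 'd) set" where "ed = (\<lambda>(s, y). {s, y})"
  define F where "F = ed ` (S \<times> T)"
  have inj: "inj_on ed (S \<times> T)"
    using assms(6) by (auto simp: inj_on_def ed_def doubleton_eq_iff)
  have Fe: "F \<subseteq> all_edges"
    using assms(6) by (auto simp: F_def ed_def intro!: doubleton_in_all_edges)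
  have finF: "finite F" using assms by (simp add: F_def)
  have cF: "card F = card S * card T"
    using card_image[OF inj] by (simp add: F_def card_cartesian_product)
  let ?X = "case_sum V \<omega>"
  let ?B = "case_sum (\<lambda>y. if y \<in> G then {c..} else {..<c}) (\<lambda>_. {t<..})"
  have B: "?B i \<in> sets borel" for i by (cases i) auto
  have evG: "{w \<in> space M. good_sites A c w = G} = (\<Inter>i\<in>Inl ` A. ?X i -` ?B i \<inter> space M)"
    using assms(2,3) by (auto simp: good_sites_def split: if_splits)
  have evA: "{w \<in> space M. good_sites A c w = G \<and> (\<forall>s\<in>S. \<forall>y\<in>T. \<not> cheap t w s y)} =
      (\<Inter>i\<in>Inl ` A \<union> Inr ` F. ?X i -` ?B i \<inter> space M)" (is "?L = ?R")
  proof -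
    have "?R = {w \<in> space M. good_sites A c w = G} \<inter> {w \<in> space M. \<forall>e\<in>F. t < \<omega> e w}"
      unfolding evG using assms(2) by (auto simp: ball_Un)
    also have "\<dots> = ?L"
      using assms(6) unfolding F_def ed_def cheap_def not_le by fastforce
    finally show ?thesis by simp
  qed
  have "prob ?R = (\<Prod>i\<in>Inl ` A \<union> Inr ` F. prob (?X i -` ?B i \<inter> space M))"
    by (rule indep_varsD[OF indep]) (use assms finF Fe B in auto)
  also have "\<dots> = (\<Prod>i\<in>Inl ` A. prob (?X i -` ?B i \<inter> space M)) *
      (\<Prod>i\<in>Inr ` F. prob (?X i -` ?B i \<inter> space M))"
    by (rule prod.union_disjoint) (use assms(1) finF in auto)
  also have "(\<Prod>i\<in>Inl ` A. prob (?X i -` ?B i \<inter> space M)) =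
      prob (\<Inter>i\<in>Inl ` A. ?X i -` ?B i \<inter> space M)"
    by (rule indep_varsD[OF indep, symmetric]) (use assms B in auto)
  also have "(\<Prod>i\<in>Inr ` F. prob (?X i -` ?B i \<inter> space M)) = (\<Prod>e\<in>F. measure \<nu> {t<..})"
    unfolding prod.reindex[OF inj_Inr[of F]] using Fe prob_noise by (intro prod.cong) auto
  finally show ?thesis unfolding evA evG by (simp add: cF)
qed

text \<open>Markov's inequality for the number of sites of weight less than \<open>c\<close>, whose mean is
  \<open>card A * measure \<mu> {..<c}\<close>.\<close>

lemma prob_few_good_sites:
  assumes "finite A" "A \<noteq> {}"
  shows "{w \<in> space M. 2 * card (good_sites A c w) < card A} \<in> events" (is "?ev \<in> _")
    and "prob {w \<in> space M. 2 * card (good_sites A c w) < card A} \<le> 2 * measure \<mu> {..<c}"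
proof -
  have cardpos: "card A > 0" using assms by (simp add: card_gt_0_iff)
  let ?b = "\<lambda>w. \<Sum>y\<in>A. indicat_real {w \<in> space M. V y w < c} w"
  have split: "real (card (good_sites A c w)) = real (card A) - ?b w" if "w \<in> space M" for w
  proof -
    have "?b w = (\<Sum>y\<in>A. if V y w < c then 1 else 0)"
      using that by (intro sum.cong) (auto simp: indicator_def)
    also have "\<dots> = real (card {y \<in> A. V y w < c})"
      using assms(1) by (simp add: sum.inter_filter[symmetric])
    also have "{y \<in> A. V y w < c} = A - good_sites A c w" by (auto simp: good_sites_def)
    also have "real (card (A - good_sites A c w)) = real (card A) - real (card (good_sites A c w))"
    proof -
      have "good_sites A c w \<subseteq> A" by (auto simp: good_sites_def)
      then show ?thesis using assms(1)
        by (simp add: card_Diff_subset card_mono finite_subset of_nat_diff)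
    qed
    finally show ?thesis by simp
  qed
  show meas: "?ev \<in> events"
  proof -
    have "?ev = {w \<in> space M. 2 * (real (card A) - ?b w) < real (card A)}"
      using split by (auto simp flip: of_nat_less_iff[where 'a = real])
    also have "\<dots> \<in> events" by measurable
    finally show ?thesis .
  qed
  have int: "integrable M (\<lambda>w. indicat_real {w \<in> space M. V y w < c} w)" for y
    by (rule integrable_real_indicator) (auto simp: less_top[symmetric])
  have each: "(\<integral>w. indicat_real {w \<in> space M. V y w < c} w \<partial>M) = measure \<mu> {..<c}" for y
  proof -
    have "V y -` {..<c} \<inter> space M = {w \<in> space M. V y w < c}" by auto
    then show ?thesis using prob_weight[of "{..<c}" y] by simp
  qed
  have "prob ?ev \<le> prob {w \<in> space M. real (card A) / 2 \<le> ?b w}"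
  proof (rule finite_measure_mono)
    show "?ev \<subseteq> {w \<in> space M. real (card A) / 2 \<le> ?b w}"
    proof
      fix w assume w: "w \<in> ?ev"
      then have "2 * real (card (good_sites A c w)) < real (card A)"
        by (metis (mono_tags, lifting) mem_Collect_eq of_nat_less_iff of_nat_mult of_nat_numeral)
      then show "w \<in> {w \<in> space M. real (card A) / 2 \<le> ?b w}" using split[of w] w by simp
    qed
  qed measurable
  also have "\<dots> \<le> (\<integral>w. ?b w \<partial>M) / (real (card A) / 2)"
    using cardpos by (intro integral_Markov_inequality_measure[where A = "{}"] Bochner_Integration.integrable_sum int)
      (auto intro!: sum_nonneg)
  also have "(\<integral>w. ?b w \<partial>M) = real (card A) * measure \<mu> {..<c}"
    by (subst Bochner_Integration.integral_sum[OF int]) (simp only: each sum_constant)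
  finally show "prob ?ev \<le> 2 * measure \<mu> {..<c}" using cardpos by simp
qed

text \<open>That \<open>\<nu>\<close> is a probability measure on the Borel sets can only be read off from the noise of some
  edge; the lattice has one because \<open>0\<close> and the all-ones vector differ.\<close>

lemma prob_space_noise: "prob_space \<nu>"
  and sets_noise: "sets \<nu> = sets borel"
proof -
  have "(0 :: int ^ 'd) \<noteq> 1" by (simp add: vec_eq_iff)
  then have e: "{0, 1 :: int ^ 'd} \<in> all_edges" by (rule doubleton_in_all_edges)
  show "prob_space \<nu>"
    using noise_law[OF e] prob_space_distr[OF noise_measurable[OF e]] by metis
  show "sets \<nu> = sets borel"
    using noise_law[OF e] by (metis sets_distr)
qed

lemma noise_above_le: "measure \<nu> {t<..} \<le> exp (- measure \<nu> {..t})"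
proof -
  interpret N: prob_space \<nu> by (rule prob_space_noise)
  have "space \<nu> = UNIV" using sets_eq_imp_space_eq[OF sets_noise] by simp
  then have "{t<..} = space \<nu> - {..t}" by auto
  then have "measure \<nu> {t<..} = 1 - measure \<nu> {..t}"
    using N.prob_compl[of "{..t}"] by (simp add: sets_noise)
  then show ?thesis using exp_ge_add_one_self[of "- measure \<nu> {..t}"] by simp
qed

text \<open>The exceptional event is split according to the set \<open>G\<close> of good sites.  Given \<open>G\<close>, a candidate
  \<open>(S, Z)\<close> leaves at least \<open>card G / 4 \<ge> n / 8\<close> sites outside \<open>Z\<close>, and none of the at
  least \<open>card S * (n / 8)\<close> edges between \<open>S\<close> and these sites is cheap.  The resulting bound is the same
  for all \<open>G\<close>, and the probabilities of the patterns \<open>G\<close> add up to at most \<open>1\<close>.\<close>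

lemma prob_good_not_expanding:
  assumes fin: "finite A" and ne: "A \<noteq> {}"
  defines "n \<equiv> card A"
  shows "\<exists>B\<in>events. prob B \<le> real n ^ 4 * exp (- measure \<nu> {..t} * n / 8) \<and>
    (\<forall>w\<in>space M - B. n \<le> 2 * card (good_sites A c w) \<longrightarrow>
       expanding (cheap t w) (good_sites A c w))"
proof -
  define b where "b = exp (- measure \<nu> {..t} * n / 8)"
  have b0: "b \<ge> 0" by (simp add: b_def)
  have n1: "real n \<ge> 1" using fin ne by (simp add: n_def Suc_le_eq card_gt_0_iff)
  show ?thesis
  proof (cases "real n ^ 3 * b \<le> 1")
    case False
    \<comment> \<open>The asserted bound then exceeds \<open>1\<close>, so the whole space serves as the exceptional event.\<close>
    then have "1 \<le> real n * (real n ^ 3 * b)"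
      using n1 mult_mono[of 1 "real n" 1 "real n ^ 3 * b"] by simp
    then have "1 \<le> real n ^ 4 * b" by (simp add: power_numeral_reduce mult.assoc)
    then show ?thesis
      by (intro bexI[of _ "space M"]) (auto simp: b_def prob_space)
  next
    case True
    let ?pat = "\<lambda>G. {w \<in> space M. good_sites A c w = G}"
    let ?cut = "\<lambda>G S Z. {w \<in> space M. good_sites A c w = G \<and> (\<forall>s\<in>S. \<forall>y\<in>G - Z. \<not> cheap t w s y)}"
    let ?GG = "{G. G \<subseteq> A \<and> n \<le> 2 * card G}"
    define B where "B = (\<Union>G\<in>?GG. \<Union>(S, Z)\<in>cut_candidates G. ?cut G S Z)"
    have finGG: "finite ?GG" by (rule finite_subset[of _ "Pow A"]) (auto simp: fin)
    have finG: "finite G" if "G \<in> ?GG" for G using that fin finite_subset by blast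
    have candD: "finite S" "finite (G - Z)" "S \<inter> (G - Z) = {}"
      if "G \<in> ?GG" "(S, Z) \<in> cut_candidates G" for G S Z
    proof -
      have "S \<subseteq> Z" "S \<subseteq> G" using that(2) by (auto simp: cut_candidates_def)
      then show "finite S" "finite (G - Z)" "S \<inter> (G - Z) = {}"
        using finG[OF that(1)] finite_subset by auto
    qed
    have ev: "?cut G S Z \<in> events" if "G \<in> ?GG" "(S, Z) \<in> cut_candidates G" for G S Z
    proof -
      have "?cut G S Z = ?pat G \<inter> {w \<in> space M. \<forall>s\<in>S. \<forall>y\<in>G - Z. \<not> cheap t w s y}" by auto
      then show ?thesis
        using sets.Int[OF good_sites_event[OF fin] no_cheap_event[OF candD[OF that]]] by simp
    qed
    have evG: "(\<Union>(S, Z)\<in>cut_candidates G. ?cut G S Z) \<in> events" if "G \<in> ?GG" for G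
      using ev[OF that] finite_cut_candidates[OF finG[OF that]] by (intro sets.finite_UN) auto
    have cut_le: "prob (?cut G S Z) \<le> prob (?pat G) * b ^ card S"
      if "G \<in> ?GG" "(S, Z) \<in> cut_candidates G" for G S Z
    proof -
      have Z: "Z \<subseteq> G" "4 * card Z \<le> 3 * card G" and G: "n \<le> 2 * card G"
        using that by (auto simp: cut_candidates_def)
      have "card (G - Z) = card G - card Z" "card Z \<le> card G"
        using Z finG[OF that(1)] by (auto simp: card_Diff_subset card_mono finite_subset)
      then have "n \<le> 8 * card (G - Z)" using Z(2) G by linarith
      then have m: "real n / 8 \<le> real (card (G - Z))" by linarith
      have "measure \<nu> {t<..} ^ (card S * card (G - Z)) = (measure \<nu> {t<..} ^ card (G - Z)) ^ card S"
        by (simp add: power_mult[symmetric] mult.commute)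
      also have "\<dots> \<le> (exp (- measure \<nu> {..t}) ^ card (G - Z)) ^ card S"
        by (intro power_mono noise_above_le) auto
      also have "exp (- measure \<nu> {..t}) ^ card (G - Z) = exp (- (measure \<nu> {..t} * card (G - Z)))"
        by (simp add: exp_of_nat_mult[symmetric] mult.commute)
      also have "(exp (- (measure \<nu> {..t} * card (G - Z)))) ^ card S \<le> b ^ card S"
        using mult_left_mono[OF m, of "measure \<nu> {..t}"]
        by (intro power_mono) (auto simp: b_def)
      finally have "measure \<nu> {t<..} ^ (card S * card (G - Z)) \<le> b ^ card S" .
      moreover have "G \<subseteq> A" using that(1) by simp
      ultimately show ?thesis
        using prob_pattern_no_cheap[OF fin ne _ candD[OF that]] by (simp add: mult_left_mono)
    qed
    have each: "prob (\<Union>(S, Z)\<in>cut_candidates G. ?cut G S Z) \<le> prob (?pat G) * (real n ^ 4 * b)"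
      if "G \<in> ?GG" for G
    proof -
      have "prob (\<Union>x\<in>cut_candidates G. ?cut G (fst x) (snd x))
          \<le> (\<Sum>x\<in>cut_candidates G. prob (?cut G (fst x) (snd x)))"
        using ev[OF that] by (intro finite_measure_subadditive_finite finite_cut_candidates finG that) auto
      also have "\<dots> \<le> (\<Sum>x\<in>cut_candidates G. prob (?pat G) * b ^ card (fst x))"
        using cut_le[OF that] by (intro sum_mono) auto
      also have "\<dots> = prob (?pat G) * (\<Sum>(S, Z)\<in>cut_candidates G. b ^ card S)"
        by (simp add: sum_distrib_left case_prod_beta)
      also have "\<dots> \<le> prob (?pat G) * (real n ^ 4 * b)"
        using that fin b0 True finG[OF that]
        by (intro mult_left_mono sum_cut_candidates_le) (auto simp: n_def card_mono)
      finally show ?thesis by (simp add: case_prod_beta)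
    qed
    have "prob B \<le> (\<Sum>G\<in>?GG. prob (\<Union>(S, Z)\<in>cut_candidates G. ?cut G S Z))"
      unfolding B_def using evG by (intro finite_measure_subadditive_finite finGG) auto
    also have "\<dots> \<le> (\<Sum>G\<in>?GG. prob (?pat G)) * (real n ^ 4 * b)"
      unfolding sum_distrib_right by (rule sum_mono[OF each])
    also have "(\<Sum>G\<in>?GG. prob (?pat G)) = prob (\<Union>G\<in>?GG. ?pat G)"
      using good_sites_event[OF fin]
      by (intro finite_measure_finite_Union[symmetric] finGG) (auto simp: disjoint_family_on_def)
    also have "prob (\<Union>G\<in>?GG. ?pat G) * (real n ^ 4 * b) \<le> 1 * (real n ^ 4 * b)"
      using b0 by (intro mult_right_mono prob_le_1) auto
    finally have "prob B \<le> real n ^ 4 * b" by simp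
    moreover have "B \<in> events" unfolding B_def by (rule sets.finite_UN[OF finGG evG])
    moreover have "expanding (cheap t w) (good_sites A c w)"
      if "w \<in> space M - B" "n \<le> 2 * card (good_sites A c w)" for w
    proof (rule ccontr)
      let ?G = "good_sites A c w"
      assume "\<not> expanding (cheap t w) ?G"
      have G: "?G \<in> ?GG" using that(2) by (auto simp: good_sites_def)
      obtain S Z where "(S, Z) \<in> cut_candidates ?G" "\<forall>s\<in>S. \<forall>y\<in>?G - Z. \<not> cheap t w s y"
        using not_expanding_cut[OF finG[OF G] \<open>\<not> expanding _ _\<close>] by blast
      then have "w \<in> B" unfolding B_def using G that(1) by blast
      then show False using that(1) by blast
    qed
    ultimately show ?thesis unfolding b_def by (intro bexI[of _ B]) auto
  qed
qed

text \<open>The sum runs over cheap edges between good sites, and each of them costs at most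
  \<open>D powr \<alpha> * t / c\<^sup>2\<close>.\<close>

lemma path_time_le:
  assumes p: "successively (cheap t w) p" "set p \<subseteq> good_sites A c w" "length p \<le> Suc L"
    and D: "\<And>y z. y \<in> A \<Longrightarrow> z \<in> A \<Longrightarrow> l1norm (y - z) \<le> D" and "0 < c" "0 \<le> t"
  shows "path_time \<alpha> V \<omega> p w \<le> real L * (D powr \<alpha> * t / c\<^sup>2)"
proof -
  let ?K = "D powr \<alpha> * t / c\<^sup>2"
  have K: "?K \<ge> 0" using assms by simp
  have "edge_time \<alpha> V \<omega> (p ! i) (p ! Suc i) w \<le> ?K" if "i < length p - 1" for i
  proof -
    let ?y = "p ! i" and ?z = "p ! Suc i"
    have i: "i < length p" "Suc i < length p" using that by auto
    then have A: "?y \<in> A" "?z \<in> A" "c \<le> V ?y w" "c \<le> V ?z w"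
      using p(2) nth_mem[OF i(1)] nth_mem[OF i(2)] unfolding good_sites_def by blast+
    have "cheap t w ?y ?z" using p(1) i by (auto simp: successively_conv_nth)
    then have "\<omega> {?y, ?z} w \<le> t" by (simp add: cheap_def)
    then have "l1norm (?y - ?z) powr \<alpha> * \<omega> {?y, ?z} w \<le> l1norm (?y - ?z) powr \<alpha> * t"
      by (intro mult_left_mono) auto
    also have "\<dots> \<le> D powr \<alpha> * t"
      using D[OF A(1,2)] alpha_pos \<open>0 \<le> t\<close>
      by (intro mult_right_mono powr_mono2) (auto simp: l1norm_def sum_nonneg)
    finally show ?thesis
      unfolding edge_time_def power2_eq_square
    proof (intro frac_le)
      show "c * c \<le> V ?y w * V ?z w" using A(3,4) \<open>0 < c\<close> by (intro mult_mono) auto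
    qed (use \<open>0 < c\<close> \<open>0 \<le> t\<close> in auto)
  qed
  then have "path_time \<alpha> V \<omega> p w \<le> (\<Sum>i<length p - 1. ?K)"
    unfolding path_time_def by (intro sum_mono) auto
  also have "\<dots> \<le> real L * ?K" using p(3) K by (simp only: sum_constant) (intro mult_right_mono, auto)
  finally show ?thesis .
qed

text \<open>A short path can be missing because \<open>u\<close> or \<open>v\<close> is not good, because fewer than half of the sites
  are good, or because the good sites are not expanding.  The term \<open>4 * measure \<mu> {..<c}\<close> counts each
  endpoint once and the number of good sites twice, as Markov's inequality does.\<close>

lemma short_path_likely:
  fixes A :: "(int ^ 'd) set"
  assumes fin: "finite A" and uv: "u \<in> A" "v \<in> A" and c: "0 < c" and t: "0 \<le> t"
    and D: "\<And>y z. y \<in> A \<Longrightarrow> z \<in> A \<Longrightarrow> l1norm (y - z) \<le> D"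
    and J: "real (card A) < (3 / 2) ^ J"
  shows "\<exists>B\<in>events. prob B \<le> 4 * measure \<mu> {..<c} +
      real (card A) ^ 4 * exp (- measure \<nu> {..t} * card A / 8) \<and>
    (\<forall>w\<in>space M - B. \<exists>p\<in>paths u v. path_time \<alpha> V \<omega> p w \<le> real (2 * J) * (D powr \<alpha> * t / c\<^sup>2))"
proof -
  have ne: "A \<noteq> {}" using uv by auto
  let ?e = "real (card A) ^ 4 * exp (- measure \<nu> {..t} * card A / 8)"
  obtain B1 where B1: "B1 \<in> events" "prob B1 \<le> ?e"
    "\<And>w. w \<in> space M - B1 \<Longrightarrow> card A \<le> 2 * card (good_sites A c w) \<Longrightarrow>
       expanding (cheap t w) (good_sites A c w)"
    using prob_good_not_expanding[OF fin ne, of t c] by blast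
  define B2 where "B2 = {w \<in> space M. 2 * card (good_sites A c w) < card A}"
  have B2: "B2 \<in> events" "prob B2 \<le> 2 * measure \<mu> {..<c}"
    unfolding B2_def using prob_few_good_sites[OF fin ne, of c] by auto
  define low where "low z = V z -` {..<c} \<inter> space M" for z
  have low: "low z \<in> events" "prob (low z) = measure \<mu> {..<c}" for z
    unfolding low_def by (auto intro: measurable_sets simp: prob_weight)
  let ?B = "(B1 \<union> B2) \<union> (low u \<union> low v)"
  have "prob ?B \<le> prob (B1 \<union> B2) + prob (low u \<union> low v)"
    using B1 B2 low by (intro measure_Un_le) auto
  also have "\<dots> \<le> (prob B1 + prob B2) + (prob (low u) + prob (low v))"
    using B1 B2 low by (intro add_mono measure_Un_le) auto
  finally have "prob ?B \<le> 4 * measure \<mu> {..<c} + ?e" using B1(2) B2(2) low(2) by simp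
  moreover have "\<exists>p\<in>paths u v. path_time \<alpha> V \<omega> p w \<le> real (2 * J) * (D powr \<alpha> * t / c\<^sup>2)"
    if w: "w \<in> space M - ?B" for w
  proof -
    let ?G = "good_sites A c w"
    have GA: "?G \<subseteq> A" by (auto simp: good_sites_def)
    have "expanding (cheap t w) ?G" using w by (intro B1(3)) (auto simp: B2_def)
    moreover have "finite ?G" using GA fin finite_subset by blast
    moreover have "symp (cheap t w)" by (auto simp: symp_def cheap_def insert_commute)
    moreover have "u \<in> ?G" "v \<in> ?G" using w uv by (auto simp: good_sites_def low_def)
    moreover have "real (card ?G) < (3 / 2) ^ J"
      using card_mono[OF fin GA] J by linarith
    ultimately obtain p where "p \<in> paths u v" "successively (cheap t w) p" "set p \<subseteq> ?G"
      "length p \<le> 2 * J + 1"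
      using expanding_short_path[of "cheap t w" ?G u v J] by blast
    then show ?thesis using path_time_le[of t w p A c "2 * J" D, OF _ _ _ D c t] by auto
  qed
  ultimately show ?thesis using B1(1) B2(1) low(1) by (intro bexI[of _ ?B]) auto
qed

lemma AE_passage_time_nonneg:
  assumes "AE s in \<mu>. s > 0"
  shows "AE w in M. \<forall>p\<in>paths u v. 0 \<le> path_time \<alpha> V \<omega> p w"
proof -
  have "AE w in M. V y w > 0" for y
    using assms unfolding weight_law[of y, symmetric] by (subst (asm) AE_distr_iff) auto
  then have "AE w in M. \<forall>y. V y w > 0" by (simp add: AE_all_countable)
  moreover have "AE w in M. y \<noteq> z \<longrightarrow> \<omega> {y, z} w \<ge> 0" for y z
  proof (cases "y = z")
    case False
    then have e: "{y, z} \<in> all_edges" by (rule doubleton_in_all_edges)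
    show ?thesis
      using noise_nonneg noise_measurable[OF e] unfolding noise_law[OF e, symmetric]
      by (subst (asm) AE_distr_iff) auto
  qed simp
  then have "AE w in M. \<forall>y z. y \<noteq> z \<longrightarrow> \<omega> {y, z} w \<ge> 0" by (simp add: AE_all_countable)
  ultimately show ?thesis
  proof eventually_elim
    case (elim w)
    have "0 \<le> edge_time \<alpha> V \<omega> y z w" if "y \<noteq> z" for y z
      unfolding edge_time_def using elim that by (simp add: less_imp_le)
    then show ?case
      unfolding path_time_def paths_def by (auto intro!: sum_nonneg simp: nth_eq_iff_index_eq)
  qed
qed

end

section \<open>Boxes in the lattice\<close>

definition centred_box :: "nat \<Rightarrow> (int ^ 'd) set" where
  "centred_box N = {y. \<forall>i. y $ i \<in> {- int N..int N}}"

lemma centred_box_finite_card: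
  "finite (centred_box N :: (int ^ 'd) set)"
  "card (centred_box N :: (int ^ 'd) set) = (2 * N + 1) ^ CARD('d)"
proof -
  let ?P = "PiE (UNIV :: 'd set) (\<lambda>_. {- int N..int N})"
  have bij: "bij_betw vec_nth (centred_box N :: (int ^ 'd) set) ?P"
    by (rule bij_betw_byWitness[where f' = vec_lambda])
      (auto simp: centred_box_def vec_lambda_inverse vec_nth_inverse)
  then show "finite (centred_box N :: (int ^ 'd) set)"
    by (simp add: bij_betw_finite[OF bij] finite_PiE)
  have "nat (2 * int N + 1) = 2 * N + 1" by simp
  then show "card (centred_box N :: (int ^ 'd) set) = (2 * N + 1) ^ CARD('d)"
    using bij_betw_same_card[OF bij] by (simp add: card_PiE)
qed

lemma centred_box_l1_diameter:
  fixes y z :: "int ^ 'd"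
  assumes "y \<in> centred_box N" "z \<in> centred_box N"
  shows "l1norm (y - z) \<le> 2 * real N * CARD('d)"
proof -
  have "\<bar>real_of_int ((y - z) $ i)\<bar> \<le> 2 * real N" for i
  proof -
    have "y $ i \<in> {- int N..int N}" "z $ i \<in> {- int N..int N}"
      using assms by (auto simp: centred_box_def)
    then have "\<bar>(y - z) $ i\<bar> \<le> 2 * int N" by auto
    then show ?thesis by linarith
  qed
  then have "l1norm (y - z) \<le> (\<Sum>i\<in>(UNIV :: 'd set). 2 * real N)"
    unfolding l1norm_def by (intro sum_mono)
  then show ?thesis by (simp add: mult.commute)
qed

lemma eventually_in_centred_box: "\<forall>\<^sub>F N in sequentially. (x :: int ^ 'd) \<in> centred_box N"
proof -
  let ?K = "nat (\<Sum>i\<in>UNIV. \<bar>x $ i\<bar>)"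
  have "x \<in> centred_box N" if "N \<ge> ?K" for N
  proof -
    have "\<bar>x $ i\<bar> \<le> int N" for i
      using member_le_sum[of i UNIV "\<lambda>i. \<bar>x $ i\<bar>"] that by simp
    then show ?thesis by (auto simp: centred_box_def abs_le_iff minus_le_iff)
  qed
  then show ?thesis unfolding eventually_sequentially by blast
qed

section \<open>Asymptotic estimates\<close>

text \<open>As \<open>ln x < 0\<close>, an upper bound on the quotient is a lower bound on \<open>ln (F x)\<close>.  The positive limit
  also excludes \<open>F x = 0\<close>, for which the quotient would be \<open>0\<close>.\<close>

lemma noise_small_lower_bound:
  fixes F :: "real \<Rightarrow> real"
  assumes lim: "((\<lambda>x. ln (F x) / ln x) \<longlongrightarrow> \<theta>) (at_right 0)" and nn: "\<And>x. F x \<ge> 0"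
    and th: "0 < \<theta>" "\<theta> < \<theta>'"
  shows "\<forall>\<^sub>F x in at_right 0. x powr \<theta>' \<le> F x"
proof -
  have "\<forall>\<^sub>F x in at_right 0. ln (F x) / ln x > 0" "\<forall>\<^sub>F x in at_right 0. ln (F x) / ln x < \<theta>'"
    using lim th by (auto simp: order_tendsto_iff)
  moreover have "\<forall>\<^sub>F x in at_right (0::real). 0 < x \<and> x < 1"
    by (auto simp: eventually_at_right_field intro: exI[of _ 1])
  ultimately show ?thesis
  proof eventually_elim
    case (elim x)
    then have "F x \<noteq> 0" by auto
    then have F: "F x > 0" using nn[of x] by simp
    have "ln x < 0" using elim by simp
    then have "\<theta>' * ln x \<le> ln (F x)" using elim(2) by (simp add: divide_less_eq)
    then have "exp (\<theta>' * ln x) \<le> F x" using F by (simp add: ln_ge_iff)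
    then show ?case using elim(3) by (simp add: powr_def)
  qed
qed

text \<open>The next two limits concern the box of radius \<open>N\<close>: a bound on the probability that the good sites
  are not expanding, with \<open>N powr \<delta>\<close> in place of the mean degree, and the cost of a path of
  logarithmic length with noise threshold \<open>N powr (- \<beta>)\<close>.\<close>

lemma failure_tendsto_0:
  fixes d :: nat and \<delta> :: real
  assumes "\<delta> > 0"
  shows "(\<lambda>N::nat. real ((2 * N + 1) ^ d) ^ 4 * exp (- (real N powr \<delta>) / 8)) \<longlonglongrightarrow> 0"
  using assms by real_asymp

lemma cost_tendsto_0:
  fixes d :: nat and \<alpha> \<beta> c :: real
  assumes "0 < \<alpha>" "\<alpha> < \<beta>" "0 < c" "0 < d"
  shows "(\<lambda>N::nat. 2 * (real d * log (3 / 2) (2 * real N + 1) + 2) *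
    ((2 * real N * real d) powr \<alpha> * real N powr (- \<beta>) / c\<^sup>2)) \<longlonglongrightarrow> 0"
proof -
  have "real d > 0" using assms by simp
  show ?thesis using assms \<open>real d > 0\<close> unfolding log_def by real_asymp
qed

lemma positive_law_near_zero:
  fixes \<mu> :: "real measure"
  assumes "prob_space \<mu>" and sets: "sets \<mu> = sets borel" and pos: "AE s in \<mu>. s > 0" and "\<eta> > 0"
  shows "\<exists>c>0. measure \<mu> {..<c} < \<eta>"
proof -
  interpret W: prob_space \<mu> by fact
  let ?c = "\<lambda>k. 1 / real (Suc k)"
  have "(\<lambda>k. measure \<mu> {..<?c k}) \<longlonglongrightarrow> measure \<mu> (\<Inter>k. {..<?c k})"
  proof (rule W.finite_Lim_measure_decseq)
    show "decseq (\<lambda>k. {..<?c k})"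
      by (intro decseq_SucI) (auto intro: less_le_trans simp: field_simps)
  qed (auto simp: sets)
  moreover have "measure \<mu> (\<Inter>k. {..<?c k}) = 0"
  proof -
    have "AE s in \<mu>. s \<notin> (\<Inter>k. {..<?c k})"
      using pos
    proof eventually_elim
      case (elim s)
      then show ?case using reals_Archimedean[OF elim] by (auto simp: inverse_eq_divide not_less intro: less_imp_le)
    qed
    then show ?thesis by (subst W.prob_eq_0) (auto simp: sets)
  qed
  ultimately have "\<forall>\<^sub>F k in sequentially. measure \<mu> {..<?c k} < \<eta>"
    using \<open>\<eta> > 0\<close> by (simp add: order_tendsto_iff)
  then obtain k where "measure \<mu> {..<?c k} < \<eta>" by (auto simp: eventually_sequentially)
  then show ?thesis by (intro exI[of _ "?c k"]) auto
qed

section \<open>Vanishing of the passage time\<close>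

text \<open>The exceptional set for a fixed \<open>e\<close> lies in the exceptional events of all smaller values, so it
  is null without any measurability of \<open>P e\<close>.\<close>

lemma (in prob_space) AE_of_arbitrarily_likely:
  fixes P :: "real \<Rightarrow> 'a \<Rightarrow> bool"
  assumes likely: "\<And>e. 0 < e \<Longrightarrow> \<exists>B\<in>events. prob B \<le> e \<and> (\<forall>w\<in>space M - B. P e w)"
    and mono: "\<And>e e' w. e \<le> e' \<Longrightarrow> P e w \<Longrightarrow> P e' w"
  shows "AE w in M. \<forall>e>0. P e w"
proof -
  let ?e = "\<lambda>k. 1 / real (Suc k)"
  have "\<forall>k. \<exists>B. B \<in> events \<and> prob B \<le> ?e k \<and> (\<forall>w\<in>space M - B. P (?e k) w)"
    using likely[of "1 / real (Suc k)" for k] by auto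
  then obtain B where B: "\<And>k. B k \<in> events" "\<And>k. prob (B k) \<le> ?e k"
    "\<And>k w. w \<in> space M - B k \<Longrightarrow> P (?e k) w"
    by metis
  have "AE w in M. P (?e m) w" for m
  proof -
    let ?I = "\<Inter>k\<in>{m..}. B k"
    have I: "?I \<in> events" using B(1) by (intro sets.countable_INT') auto
    have "prob ?I \<le> 0"
    proof (rule LIMSEQ_le_const)
      show "?e \<longlonglongrightarrow> 0" by real_asymp
      have "prob ?I \<le> ?e k" if "m \<le> k" for k
        using finite_measure_mono[of ?I "B k"] B(1,2)[of k] that by fastforce
      then show "\<exists>K. \<forall>k\<ge>K. prob ?I \<le> ?e k" by blast
    qed
    then have "prob ?I = 0" using measure_nonneg[of M ?I] by linarith
    then have "AE w in M. w \<notin> ?I" using prob_eq_0[OF I] by simp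
    then show ?thesis using AE_space
    proof eventually_elim
      case (elim w)
      then obtain k where "m \<le> k" "w \<in> space M - B k" by auto
      moreover from this have "?e k \<le> ?e m" by (simp add: frac_le)
      ultimately show ?case using B(3) mono by blast
    qed
  qed
  then have "AE w in M. \<forall>m. P (?e m) w" by (simp add: AE_all_countable)
  then show ?thesis
  proof eventually_elim
    case (elim w)
    show ?case
    proof (intro allI impI)
      fix e :: real assume "0 < e"
      then obtain m where "?e m < e" using reals_Archimedean[of e] by (auto simp: inverse_eq_divide)
      then show "P e w" using elim mono[of "?e m" e w] by simp
    qed
  qed
qed

text \<open>The constants are chosen in the order \<open>\<beta>\<close>, \<open>\<theta>'\<close>, \<open>c\<close>, \<open>N\<close>.  The two strict inequalities
  \<open>\<alpha> < \<beta>\<close> and \<open>\<beta> * \<theta>' < d\<close> make the cost vanish and the mean degree of the cheap graph a positive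
  power of \<open>N\<close>; the weights take half of the error \<open>e\<close> and the graph the other half.\<close>

lemma (in ilrfpp_standing) cheap_path_likely:
  fixes x :: "int ^ 'd"
  assumes sub: "\<alpha> < real CARD('d) / \<theta>" and e: "0 < e"
  shows "\<exists>B\<in>events. prob B \<le> e \<and>
    (\<forall>w\<in>space M - B. \<exists>p\<in>paths 0 x. path_time \<alpha> V \<omega> p w \<le> e)"
proof -
  let ?d = "CARD('d)"
  obtain \<beta> where \<beta>: "\<alpha> < \<beta>" "\<beta> < ?d / \<theta>" using dense[OF sub] by blast
  then have \<beta>0: "0 < \<beta>" using alpha_pos by simp
  have "\<theta> < ?d / \<beta>" using \<beta>(2) \<beta>0 exponents_pos by (simp add: field_simps)
  then obtain \<theta>' where \<theta>': "\<theta> < \<theta>'" "\<theta>' < ?d / \<beta>" using dense by blast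
  define \<delta> where "\<delta> = ?d - \<beta> * \<theta>'"
  have \<delta>: "0 < \<delta>" using \<theta>'(2) \<beta>0 by (simp add: \<delta>_def field_simps)
  have "0 < e / 8" using e by simp
  then obtain c where c: "0 < c" "measure \<mu> {..<c} < e / 8"
    using positive_law_near_zero[OF prob_space_weight sets_weight weight_pos] by blast
  let ?t = "\<lambda>N::nat. real N powr (- \<beta>)"
  have "filterlim ?t (at_right 0) sequentially" using \<beta>0 by real_asymp
  then have "\<forall>\<^sub>F N in sequentially. ?t N powr \<theta>' \<le> measure \<nu> {..?t N}"
    using noise_small_lower_bound[OF noise_tail _ exponents_pos(2) \<theta>'(1)]
    by (auto dest: eventually_compose_filterlim)
  moreover have "\<forall>\<^sub>F N in sequentially.
      real ((2 * N + 1) ^ ?d) ^ 4 * exp (- (real N powr \<delta>) / 8) < e / 2"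
    using order_tendstoD(2)[OF failure_tendsto_0[OF \<delta>], of "e / 2" ?d] e by simp
  moreover have "\<forall>\<^sub>F N in sequentially. 2 * (real ?d * log (3 / 2) (2 * real N + 1) + 2) *
      ((2 * real N * real ?d) powr \<alpha> * ?t N / c\<^sup>2) < e"
    by (rule order_tendstoD(2)[OF cost_tendsto_0[OF alpha_pos \<beta>(1) c(1)] e]) simp
  moreover have "\<forall>\<^sub>F N in sequentially. (0 :: int ^ 'd) \<in> centred_box N"
    "\<forall>\<^sub>F N in sequentially. x \<in> centred_box N"
    by (rule eventually_in_centred_box)+
  ultimately have "\<forall>\<^sub>F N in sequentially. ?t N powr \<theta>' \<le> measure \<nu> {..?t N} \<and>
      real ((2 * N + 1) ^ ?d) ^ 4 * exp (- (real N powr \<delta>) / 8) < e / 2 \<and>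
      2 * (real ?d * log (3 / 2) (2 * real N + 1) + 2) *
        ((2 * real N * real ?d) powr \<alpha> * ?t N / c\<^sup>2) < e \<and>
      (0 :: int ^ 'd) \<in> centred_box N \<and> x \<in> centred_box N \<and> 0 < N"
    using eventually_gt_at_top[of "0::nat"] by eventually_elim simp
  then obtain N where N: "?t N powr \<theta>' \<le> measure \<nu> {..?t N}"
    "real ((2 * N + 1) ^ ?d) ^ 4 * exp (- (real N powr \<delta>) / 8) < e / 2"
    "2 * (real ?d * log (3 / 2) (2 * real N + 1) + 2) *
        ((2 * real N * real ?d) powr \<alpha> * ?t N / c\<^sup>2) < e"
    "(0 :: int ^ 'd) \<in> centred_box N" "x \<in> centred_box N" "0 < N"
    by (auto dest: eventually_happens'[OF sequentially_bot])
  let ?A = "centred_box N :: (int ^ 'd) set"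
  define n where "n = (2 * N + 1) ^ ?d"
  have n: "card ?A = n" by (simp add: n_def centred_box_finite_card)
  have n1: "1 \<le> real n" by (simp add: n_def)
  have logn: "log (3 / 2) n = ?d * log (3 / 2) (2 * real N + 1)"
    by (simp add: n_def log_nat_power add.commute)
  \<comment> \<open>The extra step makes \<open>(3 / 2) ^ J\<close> strictly larger than \<open>n\<close>.\<close>
  define J where "J = nat \<lceil>log (3 / 2) n\<rceil> + 1"
  have "0 \<le> log (3 / 2) n" using n1 by (intro zero_le_log_cancel_iff[THEN iffD2]) auto
  then have J: "log (3 / 2) n < J" "J \<le> log (3 / 2) n + 2" unfolding J_def by linarith+
  have "real n < (3 / 2) powr J" using J(1) n1 by (subst (asm) log_less_iff) auto
  then have J': "real (card ?A) < (3 / 2) ^ J" by (simp add: n powr_realpow)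
  obtain B where B: "B \<in> events"
    "prob B \<le> 4 * measure \<mu> {..<c} + real n ^ 4 * exp (- measure \<nu> {..?t N} * n / 8)"
    "\<And>w. w \<in> space M - B \<Longrightarrow> \<exists>p\<in>paths 0 x. path_time \<alpha> V \<omega> p w \<le>
       real (2 * J) * ((2 * real N * ?d) powr \<alpha> * ?t N / c\<^sup>2)"
    using short_path_likely[of ?A 0 x c "?t N" "2 * real N * ?d" J,
        OF centred_box_finite_card(1) N(4,5) c(1) powr_ge_zero centred_box_l1_diameter J']
    unfolding n by blast
  have "real N powr \<delta> = (real N powr (- \<beta>)) powr \<theta>' * real N ^ ?d"
    using N(6) by (simp add: \<delta>_def powr_powr powr_add[symmetric] powr_realpow[symmetric])
  also have "\<dots> \<le> measure \<nu> {..?t N} * real n"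
    using N(1) by (intro mult_mono) (auto simp: n_def intro!: power_mono)
  finally have "real n ^ 4 * exp (- measure \<nu> {..?t N} * n / 8) \<le>
      real n ^ 4 * exp (- (real N powr \<delta>) / 8)"
    by (intro mult_left_mono) auto
  then have "prob B \<le> e" using B(2) N(2) c(2) unfolding n_def by linarith
  moreover have "real (2 * J) * ((2 * real N * ?d) powr \<alpha> * ?t N / c\<^sup>2) \<le> e"
  proof -
    have "real (2 * J) * ((2 * real N * ?d) powr \<alpha> * ?t N / c\<^sup>2) \<le>
        2 * (real ?d * log (3 / 2) (2 * real N + 1) + 2) * ((2 * real N * ?d) powr \<alpha> * ?t N / c\<^sup>2)"
      using J(2) unfolding logn by (intro mult_right_mono) auto
    then show ?thesis using N(3) by linarith
  qed
  ultimately show ?thesis using B(1,3) by (meson order_trans)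
qed

theorem theorem3p1:
  fixes M :: "'w measure"
    and V :: "int ^ 'd \<Rightarrow> 'w \<Rightarrow> real"
    and \<omega> :: "(int ^ 'd) set \<Rightarrow> 'w \<Rightarrow> real"
    and \<mu> \<nu> :: "real measure"
    and \<alpha> \<gamma> \<theta> \<zeta> :: real
    and x :: "int ^ 'd"
  assumes "ilrfpp_standing M \<alpha> V \<omega> \<mu> \<nu> \<gamma> \<theta> \<zeta>"
    and "\<alpha> < real CARD('d) / \<theta>"
  shows "AE w in M. passage_time \<alpha> V \<omega> 0 x w = 0"
proof -
  interpret ilrfpp_standing M \<alpha> V \<omega> \<mu> \<nu> \<gamma> \<theta> \<zeta> by fact
  have "AE w in M. \<forall>e>0. \<exists>p\<in>paths 0 x. path_time \<alpha> V \<omega> p w \<le> e"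
    by (rule AE_of_arbitrarily_likely[OF cheap_path_likely[OF assms(2)]]) (auto intro: order_trans)
  then show ?thesis using AE_passage_time_nonneg[OF weight_pos, of 0 x]
  proof eventually_elim
    case (elim w)
    have ne: "paths 0 x \<noteq> {}" using elim(1) zero_less_one by blast
    have bdd: "bdd_below ((\<lambda>p. path_time \<alpha> V \<omega> p w) ` paths 0 x)"
      using elim(2) by (auto intro: bdd_belowI2)
    have "passage_time \<alpha> V \<omega> 0 x w \<le> 0 + e" if e: "0 < e" for e
    proof -
      obtain p where "p \<in> paths 0 x" "path_time \<alpha> V \<omega> p w \<le> e" using elim(1) e by blast
      then show ?thesis unfolding passage_time_def by (simp add: cINF_lower2[OF bdd])
    qed
    then have "passage_time \<alpha> V \<omega> 0 x w \<le> 0" by (rule field_le_epsilon)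
    moreover have "0 \<le> passage_time \<alpha> V \<omega> 0 x w"
      unfolding passage_time_def using elim(2) by (intro cINF_greatest ne) auto
    ultimately show ?case by (rule antisym)
  qed
qed

end
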